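(* Let $(\mathcal N,\mathcal O,\mathfrak l)$ be an acyclically oriented plabic network, which possesses neither internal sources nor internal sinks, representing a point in an irreducible positroid cell, where $\mathcal O=\mathcal O(I)$. Then all edge vectors $E_e$ (both the internal and the boundary ones) are non-null. Moreover, in this case $$E_e=\sum_{j\in\bar I}\Big(\sum_{F\in\mathcal F_{e,b_j}(\mathcal G)}(-1)^{\mathrm{wind}(F)+\mathrm{int}(F)}w(F)\Big)E_j=\sum_{j\in\bar I}\Big((-1)^{\sigma(e,b_j)}\sum_{F\in\mathcal F_{e,b_j}(\mathcal G)}w(F)\Big)E_j,$$ where $E_j$ is the $j$-th canonical basis vector, the inner sums run over all directed paths $F$ starting at $e$ and ending at $b_j$, and the parity $\sigma(e,b_j)$ of $\mathrm{wind}(F)+\mathrm{int}(F)$ is the same for all such $F$. In particular, this formula holds for all edges of Le-networks representing points in irreducible positroid cells.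
   Context: **Plabic networks.** Let $D$ be a closed convex disk whose boundary contains a straight segment. A plabic graph $\mathcal G$ is a finite directed planar graph embedded in $D$ with straight edges. It has boundary vertices $b_1,\dots,b_n$ on the segment, labelled clockwise, each of degree 1 (a source if its edge is outgoing, a sink otherwise). The remaining (internal) vertices lie inside $D$ and have degree 2 or 3. No component is isolated from the boundary. The graph is perfect: each internal vertex has exactly one incoming edge (then it is white) or exactly one outgoing edge (then it is black); bivalent vertices have one incoming and one outgoing edge and either color. The orientation is called a perfect orientation. $I$ is the set of indices of the boundary sources, $\bar I=[n]\setminus I$, $\mathcal O=\mathcal O(I)$. A network $\mathcal N$ has a positive weight $w_e$ on each edge. Acyclically oriented: there are no directed cycles. **Positroid cell.** $\mathcal M$ is the set of source sets of all perfect orientations of $\mathcal G$ compatible with the coloring. The network represents (via Postnikov's boundary measurement map) a point of the cell $\mathcal S^{\mathrm{TNN}}_{\mathcal M}$ of points of $Gr^{\mathrm{TNN}}(k,n)$ with $\Delta_J>0$ for $J\in\mathcal M$ and $\Delta_J=0$ otherwise. The cell is irreducible if for every $j\in[n]$ there are $J,J'\in\mathcal M$ with $j\in J$, $j\notin J'$. **Gauge rays.** A gauge ray direction $\mathfrak l$ is an oriented direction, not parallel to any edge, such that the rays with direction $\mathfrak l$ starting at boundary vertices point inside $D$ and contain no internal vertices. The gauge rays are those starting at the boundary sources, and $\mathrm{int}(e)$ is the number of their intersections with $e$ (base points not counted). **Winding.** $s(a,b)=+1,0,-1$ if the ordered pair $(a,b)$ is positively oriented, parallel, negatively oriented. For consecutive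 directed edges: $\mathrm{wind}(e,f)=\pm1$ if $s(e,f)=s(e,\mathfrak l)=s(\mathfrak l,f)=\pm1$; otherwise $0$. **Edge vectors.** For a directed path $\mathcal P=(e_1,\dots,e_m)$: $w(\mathcal P)=\prod_lw_{e_l}$, $\mathrm{wind}(\mathcal P)=\sum_{l<m}\mathrm{wind}(e_l,e_{l+1})$, $\mathrm{int}(\mathcal P)=\sum_l\mathrm{int}(e_l)$. $E_e\in\mathbb R^n$ has components $(E_e)_j=\sum_{\mathcal P:e\to b_j}(-1)^{\mathrm{wind}(\mathcal P)+\mathrm{int}(\mathcal P)}w(\mathcal P)$ over all directed paths with first edge $e$ ending at $b_j$ (zero if none). In the acyclic case the sum is finite, and $\mathcal F_{e,b_j}(\mathcal G)$ (the edge flows from $e$ to $b_j$) is exactly the set of these paths. **Le-networks.** The (acyclically oriented, perfect) plabic networks associated by Postnikov to Le-diagrams. A Le-diagram is a filling of a Young diagram inside a $k\times(n-k)$ rectangle by 0s and 1s in which no 0 has both a 1 to its left in the same row and a 1 above it in the same column. The boundary vertices are the steps of the southeast border labelled from northeast to southwest (vertical steps are sources, horizontal steps are sinks). From each source a line goes left through the 1s of its row, and from each 1 a line goes down through the 1s of its column to the sink of that column. Horizontal edges are directed leftwards and vertical ones downwards, and each vertex with two incoming and two outgoing edges is resolved into a black vertex (collecting the incoming edges) followed by a white vertex (splitting into the outgoing edges). *)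

theory Defs
  imports "HOL-Analysis.Analysis"
begin

section \<open>Plabic graphs and networks\<close>

text \<open>
  The plane is the type of complex numbers, with its usual (counterclockwise) orientation.
  A vertex is a point of the plane and an edge is the ordered pair of its endpoints, drawn as a
  straight segment; two vertices are therefore joined by at most one edge.
  The boundary vertices are indexed by a finite linearly ordered type, which plays the role
  of \<open>[n]\<close>; its order is the clockwise labelling.
\<close>

text \<open>\<open>orient a b\<close> is the sign \<open>s(a,b)\<close>.\<close>

definition orient :: "complex \<Rightarrow> complex \<Rightarrow> int" where
  "orient a b = (if Im (cnj a * b) > 0 then 1 else if Im (cnj a * b) = 0 then 0 else -1)"

text \<open>The internal vertices that are not in \<open>white\<close> are black.\<close>

record 'n plabic_graph =
  disk :: "complex set"
  bdry :: "'n \<Rightarrow> complex"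
  inner :: "complex set"
  white :: "complex set"
  edges :: "(complex \<times> complex) set"

record 'n plabic_network = "'n plabic_graph" +
  weight :: "complex \<times> complex \<Rightarrow> real"

definition vertices :: "('n, 'z) plabic_graph_scheme \<Rightarrow> complex set" where
  "vertices G = range (bdry G) \<union> inner G"

definition degree_at :: "('n, 'z) plabic_graph_scheme \<Rightarrow> complex \<Rightarrow> nat" where
  "degree_at G v = card {e \<in> edges G. fst e = v \<or> snd e = v}"

text \<open>
  The disk is a convex body and \<open>closed_segment p q\<close> is a segment of its boundary. Running
  clockwise along the boundary, from \<open>p\<close> to \<open>q\<close>, one has the disk on the right.
\<close>

definition bdry_on_segment :: "('n::{finite,linorder}, 'z) plabic_graph_scheme \<Rightarrow> bool" where
  "bdry_on_segment G \<longleftrightarrow>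
     compact (disk G) \<and> convex (disk G) \<and> interior (disk G) \<noteq> {} \<and>
     (\<exists>p q. p \<noteq> q \<and> closed_segment p q \<subseteq> frontier (disk G) \<and>
        (\<forall>x\<in>disk G. orient (q - p) (x - p) \<le> 0) \<and>
        (\<exists>t :: 'n \<Rightarrow> real. strict_mono t \<and>
           (\<forall>i. 0 \<le> t i \<and> t i \<le> 1 \<and> bdry G i = p + t i *\<^sub>R (q - p))))"

text \<open>
  Edges meet only at common endpoints. The last condition also excludes two opposite edges
  on the same segment.
\<close>

definition straight_planar :: "('n, 'z) plabic_graph_scheme \<Rightarrow> bool" where
  "straight_planar G \<longleftrightarrow>
     finite (inner G) \<and> inner G \<subseteq> interior (disk G) \<and>
     edges G \<subseteq> vertices G \<times> vertices G \<and>
     (\<forall>(u, v)\<in>edges G. u \<noteq> v \<and> closed_segment u v \<inter> vertices G = {u, v}) \<and>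
     (\<forall>(u, v)\<in>edges G. \<forall>(u', v')\<in>edges G. (u, v) \<noteq> (u', v') \<longrightarrow>
        closed_segment u v \<inter> closed_segment u' v' \<subseteq> {u, v} \<inter> {u', v'})"

text \<open>
  \<open>perfect_orientation G Or\<close>: the set \<open>Or\<close> of directed edges orients the undirected graph
  underlying \<open>G\<close>, compatibly with the colouring.
\<close>

definition perfect_orientation ::
    "('n, 'z) plabic_graph_scheme \<Rightarrow> (complex \<times> complex) set \<Rightarrow> bool" where
  "perfect_orientation G Or \<longleftrightarrow>
     Or \<union> Or\<inverse> = edges G \<union> (edges G)\<inverse> \<and> Or \<inter> Or\<inverse> = {} \<and>
     (\<forall>v\<in>white G. card {u. (u, v) \<in> Or} = 1) \<and>
     (\<forall>v\<in>inner G - white G. card {u. (v, u) \<in> Or} = 1)"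

definition plabic_graph :: "('n::{finite,linorder}, 'z) plabic_graph_scheme \<Rightarrow> bool" where
  "plabic_graph G \<longleftrightarrow>
     bdry_on_segment G \<and> straight_planar G \<and>
     (\<forall>i. degree_at G (bdry G i) = 1) \<and>
     (\<forall>v\<in>inner G. degree_at G v \<in> {2, 3}) \<and>
     (\<forall>v\<in>inner G. \<exists>i. (v, bdry G i) \<in> (edges G \<union> (edges G)\<inverse>)\<^sup>*) \<and>
     white G \<subseteq> inner G \<and> perfect_orientation G (edges G)"

definition plabic_network :: "'n::{finite,linorder} plabic_network \<Rightarrow> bool" where
  "plabic_network N \<longleftrightarrow> plabic_graph N \<and> (\<forall>e\<in>edges N. weight N e > 0)"

definition internal_sources :: "('n, 'z) plabic_graph_scheme \<Rightarrow> complex set" where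
  "internal_sources G = {v \<in> inner G. \<forall>u. (u, v) \<notin> edges G}"

definition internal_sinks :: "('n, 'z) plabic_graph_scheme \<Rightarrow> complex set" where
  "internal_sinks G = {v \<in> inner G. \<forall>u. (v, u) \<notin> edges G}"


section \<open>The positroid of a plabic graph\<close>

definition source_set ::
    "('n, 'z) plabic_graph_scheme \<Rightarrow> (complex \<times> complex) set \<Rightarrow> 'n set" where
  "source_set G Or = {i. \<exists>v. (bdry G i, v) \<in> Or}"

abbreviation sources :: "('n, 'z) plabic_graph_scheme \<Rightarrow> 'n set" where
  "sources G \<equiv> source_set G (edges G)"

text \<open>
  A network on \<open>G\<close> represents a point of the positroid cell on which exactly the Pluecker
  coordinates indexed by the elements of \<open>positroid G\<close> are non-zero (positive). The cell, and
  hence its irreducibility, depends on the network only through this set.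
\<close>

definition positroid :: "('n, 'z) plabic_graph_scheme \<Rightarrow> 'n set set" where
  "positroid G = {source_set G Or | Or. perfect_orientation G Or}"

definition irreducible_cell :: "'n set set \<Rightarrow> bool" where
  "irreducible_cell M \<longleftrightarrow> (\<forall>j. \<exists>J\<in>M. \<exists>J'\<in>M. j \<in> J \<and> j \<notin> J')"


section \<open>Gauge rays, winding and edge vectors\<close>

definition gauge_ray_direction :: "('n, 'z) plabic_graph_scheme \<Rightarrow> complex \<Rightarrow> bool" where
  "gauge_ray_direction G l \<longleftrightarrow>
     l \<noteq> 0 \<and>
     (\<forall>(u, v)\<in>edges G. orient (v - u) l \<noteq> 0) \<and>
     (\<forall>i. \<exists>d>0. \<forall>t. 0 < t \<and> t < d \<longrightarrow> bdry G i + t *\<^sub>R l \<in> interior (disk G)) \<and>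
     (\<forall>i. \<forall>t\<ge>0. bdry G i + t *\<^sub>R l \<notin> inner G)"

text \<open>Pairs of a gauge ray, given by its boundary source, and a point where it meets the edge.\<close>

definition ray_crossings ::
    "('n, 'z) plabic_graph_scheme \<Rightarrow> complex \<Rightarrow> complex \<times> complex \<Rightarrow> nat" where
  "ray_crossings G l e =
     card {(i, x). i \<in> sources G \<and> x \<in> closed_segment (fst e) (snd e) \<and>
             (\<exists>t>0. x = bdry G i + t *\<^sub>R l)}"

definition wind_pair ::
    "complex \<Rightarrow> complex \<times> complex \<Rightarrow> complex \<times> complex \<Rightarrow> int" where
  "wind_pair l e f =
     (let a = snd e - fst e; b = snd f - fst f in
      if orient a b = orient a l \<and> orient a l = orient l b then orient a b else 0)"

definition directed_paths ::
    "('n, 'z) plabic_graph_scheme \<Rightarrow> complex \<times> complex \<Rightarrow> 'n \<Rightarrow> (complex \<times> complex) list set" where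
  "directed_paths G e j =
     {P. P \<noteq> [] \<and> set P \<subseteq> edges G \<and> hd P = e \<and> snd (last P) = bdry G j \<and>
         (\<forall>m. Suc m < length P \<longrightarrow> snd (P ! m) = fst (P ! Suc m))}"

definition path_weight :: "'n plabic_network \<Rightarrow> (complex \<times> complex) list \<Rightarrow> real" where
  "path_weight N P = (\<Prod>m<length P. weight N (P ! m))"

definition path_wind :: "complex \<Rightarrow> (complex \<times> complex) list \<Rightarrow> int" where
  "path_wind l P = (\<Sum>m<length P - 1. wind_pair l (P ! m) (P ! Suc m))"

definition path_int ::
    "('n, 'z) plabic_graph_scheme \<Rightarrow> complex \<Rightarrow> (complex \<times> complex) list \<Rightarrow> nat" where
  "path_int G l P = (\<Sum>m<length P. ray_crossings G l (P ! m))"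

text \<open>Meant for acyclic networks, where there are finitely many directed paths.\<close>

definition edge_vector ::
    "'n::finite plabic_network \<Rightarrow> complex \<Rightarrow> complex \<times> complex \<Rightarrow> real ^ 'n" where
  "edge_vector N l e =
     (\<chi> j. \<Sum>P\<in>directed_paths N e j.
        (-1) powi (path_wind l P + int (path_int N l P)) * path_weight N P)"


section \<open>Le-networks\<close>

text \<open>
  A Young diagram inside the \<open>k \<times> (n - k)\<close> rectangle is the list \<open>lam\<close> of its \<open>k\<close> row lengths,
  zeros allowed. Rows (from the top) and columns (from the left) are counted from 0.
\<close>

definition young_diagram :: "nat \<Rightarrow> nat list \<Rightarrow> bool" where
  "young_diagram n lam \<longleftrightarrow>
     length lam \<le> n \<and> sorted_wrt (\<ge>) lam \<and> (\<forall>x\<in>set lam. x \<le> n - length lam)"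

definition boxes :: "nat list \<Rightarrow> (nat \<times> nat) set" where
  "boxes lam = {(r, c). r < length lam \<and> c < lam ! r}"

text \<open>A filling is given by the set \<open>D\<close> of the boxes filled with 1.\<close>

definition one_left :: "(nat \<times> nat) set \<Rightarrow> nat \<Rightarrow> nat \<Rightarrow> bool" where
  "one_left D r c \<longleftrightarrow> (\<exists>c'<c. (r, c') \<in> D)"

definition one_above :: "(nat \<times> nat) set \<Rightarrow> nat \<Rightarrow> nat \<Rightarrow> bool" where
  "one_above D r c \<longleftrightarrow> (\<exists>r'<r. (r', c) \<in> D)"

definition le_diagram :: "nat \<Rightarrow> nat list \<Rightarrow> (nat \<times> nat) set \<Rightarrow> bool" where
  "le_diagram n lam D \<longleftrightarrow>
     young_diagram n lam \<and> D \<subseteq> boxes lam \<and>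
     (\<forall>(r, c)\<in>boxes lam - D. \<not> (one_left D r c \<and> one_above D r c))"

text \<open>
  The number of steps of the southeast border, from northeast to southwest, that precede the
  vertical step of row \<open>r\<close>, respectively the horizontal step of column \<open>c\<close>.
\<close>

definition row_step :: "nat \<Rightarrow> nat list \<Rightarrow> nat \<Rightarrow> nat" where
  "row_step n lam r = r + (n - length lam - lam ! r)"

definition col_step :: "nat \<Rightarrow> nat list \<Rightarrow> nat \<Rightarrow> nat" where
  "col_step n lam c = (n - length lam - Suc c) + card {r. r < length lam \<and> c < lam ! r}"

text \<open>
  \<open>Step m\<close> is the boundary vertex preceded by \<open>m\<close> others. A box filled with 1 gives one vertex
  \<open>Entry r c\<close>, or, if it has both a 1 to its left and a 1 above it, the vertex \<open>Entry r c\<close>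
  collecting the incoming edges and the vertex \<open>Exit r c\<close> splitting into the outgoing ones.
\<close>

datatype le_vertex = Step nat | Entry nat nat | Exit nat nat

definition resolved :: "(nat \<times> nat) set \<Rightarrow> nat \<Rightarrow> nat \<Rightarrow> bool" where
  "resolved D r c \<longleftrightarrow> (r, c) \<in> D \<and> one_left D r c \<and> one_above D r c"

definition out_vertex :: "(nat \<times> nat) set \<Rightarrow> nat \<Rightarrow> nat \<Rightarrow> le_vertex" where
  "out_vertex D r c = (if resolved D r c then Exit r c else Entry r c)"

definition le_vertices :: "nat \<Rightarrow> (nat \<times> nat) set \<Rightarrow> le_vertex set" where
  "le_vertices n D =
     Step ` {..<n} \<union> {Entry r c | r c. (r, c) \<in> D} \<union> {Exit r c | r c. resolved D r c}"

definition le_horizontal ::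
    "nat \<Rightarrow> nat list \<Rightarrow> (nat \<times> nat) set \<Rightarrow> (le_vertex \<times> le_vertex) set" where
  "le_horizontal n lam D =
     {(Step (row_step n lam r), Entry r c) | r c.
        (r, c) \<in> D \<and> (\<forall>c'>c. (r, c') \<notin> D)} \<union>
     {(out_vertex D r c, Entry r c') | r c c'.
        (r, c) \<in> D \<and> (r, c') \<in> D \<and> c' < c \<and> (\<forall>d. c' < d \<and> d < c \<longrightarrow> (r, d) \<notin> D)}"

definition le_vertical ::
    "nat \<Rightarrow> nat list \<Rightarrow> (nat \<times> nat) set \<Rightarrow> (le_vertex \<times> le_vertex) set" where
  "le_vertical n lam D =
     {(out_vertex D r c, Step (col_step n lam c)) | r c.
        (r, c) \<in> D \<and> (\<forall>r'>r. (r', c) \<notin> D)} \<union>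
     {(out_vertex D r c, Entry r' c) | r r' c.
        (r, c) \<in> D \<and> (r', c) \<in> D \<and> r < r' \<and> (\<forall>d. r < d \<and> d < r' \<longrightarrow> (d, c) \<notin> D)}"

definition le_resolving :: "(nat \<times> nat) set \<Rightarrow> (le_vertex \<times> le_vertex) set" where
  "le_resolving D = {(Entry r c, Exit r c) | r c. resolved D r c}"

text \<open>
  For three distinct directions the sum below is negative iff they occur in the clockwise
  cyclic order: at most one of the three angles between successive directions is \<open>\<ge> \<pi>\<close>.
\<close>

definition clockwise_at :: "complex \<Rightarrow> complex \<Rightarrow> complex \<Rightarrow> complex \<Rightarrow> bool" where
  "clockwise_at v x y z \<longleftrightarrow>
     orient (x - v) (y - v) + orient (y - v) (z - v) + orient (z - v) (x - v) < 0"

text \<open>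
  A Le-network is a plabic network whose graph is a straight-line drawing in the disk of the
  graph of a Le-diagram: \<open>f\<close> identifies the vertices, the edges and the boundary labels, and
  preserves the cyclic order of the edges around each trivalent vertex. In the diagram this
  order is, clockwise: incoming from above, incoming from the right, outgoing downwards,
  outgoing to the left. The edge inside a resolved box points southwest, so it counts as
  outgoing downwards at its tail and as incoming from the right at its head. The colours of the
  trivalent vertices are forced by the orientation.
\<close>

definition le_network :: "'n::{finite,linorder} plabic_network \<Rightarrow> bool" where
  "le_network N \<longleftrightarrow>
     plabic_network N \<and>
     (\<exists>lam D f.
        let n = CARD('n); H = le_horizontal n lam D; V = le_vertical n lam D; R = le_resolving D
        in le_diagram n lam D \<and>
           bij_betw f (le_vertices n D) (vertices N) \<and>
           (\<forall>i. f (Step (card {i'. i' < i})) = bdry N i) \<and>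
           edges N = map_prod f f ` (H \<union> V \<union> R) \<and>
           (\<forall>a b c x. (a, x) \<in> V \<and> (b, x) \<in> H \<and> (x, c) \<in> V \<union> R \<longrightarrow>
              clockwise_at (f x) (f a) (f b) (f c)) \<and>
           (\<forall>a b c x. (a, x) \<in> H \<union> R \<and> (x, b) \<in> V \<and> (x, c) \<in> H \<longrightarrow>
              clockwise_at (f x) (f a) (f b) (f c)))"

end

theory Submission
  imports Defs
begin

text \<open>
  A path between two boundary vertices is a simple polygonal arc whose interior points lie strictly
  on one side of the line through its endpoints. As in Hopf's proof of the rotation theorem, its
  total turning is the turning of the secants from the first point plus that of the secants to the
  last point; both stay in a half plane, so the turning, and hence the winding, depends only on the
  first and the last edge. A path starting at an arbitrary edge is first extended backwards to a
  boundary source. The parity of the number of intersections with the gauge rays is determined by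
  the ends of the path because a ray separates the endpoints of precisely those internal edges that
  cross it. So all paths from an edge to a boundary sink contribute with the same sign.
\<close>

section \<open>Turning of polygonal arcs\<close>

text \<open>Conjugation flips the sign of the imaginary part, so up to a positive factor
  \<open>Im (- a / l)\<close> carries the sign of \<open>orient a l\<close>.\<close>

lemma Im_divide_pos_iff:
  fixes a l :: complex
  assumes "l \<noteq> 0"
  shows "Im (- a / l) > 0 \<longleftrightarrow> Im (cnj a * l) > 0" "Im (- a / l) < 0 \<longleftrightarrow> Im (cnj a * l) < 0"
proof -
  have "(cmod l)\<^sup>2 > 0" using assms by simp
  moreover have "Im (- a / l) = Im (cnj a * l) / (cmod l)\<^sup>2"
    by (simp add: Im_divide cmod_power2 flip: minus_divide_left) (simp add: algebra_simps minus_divide_left)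
  ultimately show "Im (- a / l) > 0 \<longleftrightarrow> Im (cnj a * l) > 0" "Im (- a / l) < 0 \<longleftrightarrow> Im (cnj a * l) < 0"
    by (simp_all add: zero_less_divide_iff divide_less_0_iff)
qed

lemma Re_divide_nonneg_iff:
  fixes a d :: complex
  assumes "d \<noteq> 0"
  shows "Re (a / d) \<ge> 0 \<longleftrightarrow> d \<bullet> a \<ge> 0" "Re (a / d) > 0 \<longleftrightarrow> d \<bullet> a > 0"
proof -
  have "(cmod d)\<^sup>2 > 0" using assms by simp
  moreover have "Re (a / d) = (d \<bullet> a) / (cmod d)\<^sup>2"
    by (simp add: Re_divide cmod_power2 inner_complex_def algebra_simps)
  ultimately show "Re (a / d) \<ge> 0 \<longleftrightarrow> d \<bullet> a \<ge> 0" "Re (a / d) > 0 \<longleftrightarrow> d \<bullet> a > 0"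
    by (simp_all add: zero_less_divide_iff zero_le_divide_iff)
qed

definition turn :: "complex \<Rightarrow> complex \<Rightarrow> real" where
  "turn a b = Arg (b / a)"

text \<open>Measured from \<open>d\<close>, both angles are at most a right angle and one is
  strictly smaller. Their difference stays below pi, so the principal argument of the quotient needs
  no correction by a full turn.\<close>

lemma turn_halfplane:
  assumes "d \<bullet> a > 0" "d \<bullet> b \<ge> 0 \<and> b \<noteq> 0"
  shows "turn a b = Arg (b / d) - Arg (a / d)" "turn b a = Arg (a / d) - Arg (b / d)"
proof -
  have nz: "d \<noteq> 0" "a \<noteq> 0" "b \<noteq> 0" using assms by auto
  have "\<bar>Arg (a / d)\<bar> < pi / 2" "\<bar>Arg (b / d)\<bar> \<le> pi / 2"
    using assms nz by (simp_all only: Arg_Re_pos Arg_Re_nonneg Re_divide_nonneg_iff simp_thms)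
  then have "\<bar>Arg (b / d) - Arg (a / d)\<bar> < pi" by linarith
  then show "turn a b = Arg (b / d) - Arg (a / d)" "turn b a = Arg (a / d) - Arg (b / d)"
    using nz Arg_divide'[of "b / d" "a / d"] Arg_divide'[of "a / d" "b / d"]
    by (simp_all add: turn_def abs_less_iff)
qed

lemma turn_trans_halfplane:
  assumes "d \<bullet> a > 0" "d \<bullet> b > 0" "d \<bullet> c > 0"
  shows "turn a b + turn b c = turn a c"
proof -
  have "a \<noteq> 0" "b \<noteq> 0" "c \<noteq> 0" using assms by auto
  then show ?thesis
    using turn_halfplane(1)[of d a b] turn_halfplane(1)[of d b c] turn_halfplane(1)[of d a c] assms
    by simp
qed

text \<open>\<open>Arg (- a / l)\<close> is the angle of \<open>a\<close> measured with its branch cut in the direction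
  \<open>l\<close>, so it jumps by \<open>2 * pi\<close> exactly when the winding counts a passage through \<open>l\<close>.\<close>

lemma wind_pair_eq_turn:
  assumes "orient a l \<noteq> 0" "orient b l \<noteq> 0" "Arg (b / a) \<noteq> pi"
    and "a = snd e - fst e" "b = snd f - fst f"
  shows "2 * pi * of_int (wind_pair l e f) = turn a b + Arg (- a / l) - Arg (- b / l)"
proof -
  have nz: "a \<noteq> 0" "b \<noteq> 0" "l \<noteq> 0" using assms(1,2) by (auto simp: orient_def)
  define A where "A = - a / l"
  define B where "B = - b / l"
  have nz': "A \<noteq> 0" "B \<noteq> 0" using nz by (auto simp: A_def B_def)
  have q: "b / a = B / A" using nz by (simp add: A_def B_def)
  define X where "X = Arg A" define Y where "Y = Arg B" define Z where "Z = Arg (b / a)"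
  \<comment> \<open>Arguments subtract up to one correction by a full turn; this correction is what
    the winding records.\<close>
  have Z: "Z = Y - X + (if Y - X > pi then -2 * pi else if Y - X \<le> -pi then 2 * pi else 0)"
    unfolding X_def Y_def Z_def q using Arg_divide'[OF nz'(2,1)] by simp
  \<comment> \<open>With the half turn excluded, the sign of \<open>Z\<close> is the orientation of
    the pair \<open>a\<close>, \<open>b\<close>.\<close>
  have bz: "-pi < Z" "Z < pi" using assms(3) Arg_bounded[of "b/a"] by (auto simp: Z_def)
  have sX: "Im (cnj a * l) > 0 \<longleftrightarrow> 0 < X \<and> X < pi" "Im (cnj a * l) < 0 \<longleftrightarrow> X < 0" "-pi < X"
    and sY: "Im (cnj b * l) > 0 \<longleftrightarrow> 0 < Y \<and> Y < pi" "Im (cnj b * l) < 0 \<longleftrightarrow> Y < 0" "-pi < Y"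
    using Arg_bounded unfolding X_def Y_def A_def B_def
    by (simp_all only: Arg_lt_pi Arg_neg_iff Im_divide_pos_iff[OF nz(3)])
  have oa: "orient a l = (if 0 < X \<and> X < pi then 1 else -1)" "0 < X \<and> X < pi \<or> -pi < X \<and> X < 0"
    using assms(1) sX by (auto simp: orient_def split: if_splits)
  have "orient l b = - orient b l" by (auto simp: orient_def algebra_simps)
  then have ob: "orient l b = (if 0 < Y \<and> Y < pi then -1 else 1)" "0 < Y \<and> Y < pi \<or> -pi < Y \<and> Y < 0"
    using assms(2) sY by (auto simp: orient_def split: if_splits)
  have "Im (cnj a * b) = Im (b / a) * (cmod a)\<^sup>2" "(cmod a)\<^sup>2 > 0"
    using nz by (simp_all add: Im_divide flip: cmod_power2)
  then have "orient a b = (if Im (b / a) > 0 then 1 else if Im (b / a) = 0 then 0 else -1)"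
    using nz by (auto simp: orient_def zero_less_mult_iff)
  moreover have "Im (b / a) > 0 \<longleftrightarrow> Z > 0" "Im (b / a) < 0 \<longleftrightarrow> Z < 0"
    using Arg_lt_pi[of "b/a"] Arg_neg_iff[of "b/a"] bz by (auto simp: Z_def)
  ultimately have oab: "orient a b = (if Z > 0 then 1 else if Z = 0 then 0 else -1)"
    by auto
  have "2 * pi * of_int (wind_pair l e f) = Z + X - Y"
    unfolding wind_pair_def Let_def assms(4,5)[symmetric] oab oa(1) ob(1)
    using oa(2) ob(2) Z bz by (elim disjE conjE) (auto split: if_splits)
  then show ?thesis by (simp add: turn_def X_def Y_def Z_def A_def B_def)
qed

text \<open>A line separates the two segments, so all four secants between them lie in one open half
  plane. There turning is additive, and both sides equal the turn from \<open>c - a\<close> to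
  \<open>d - b\<close>.\<close>

lemma turn_square:
  assumes "closed_segment a b \<inter> closed_segment c d = {}"
  shows "turn (c - a) (d - a) + turn (d - a) (d - b) = turn (c - a) (c - b) + turn (c - b) (d - b)"
proof -
  obtain n \<beta> where "\<forall>x\<in>closed_segment a b. n \<bullet> x < \<beta>" "\<forall>x\<in>closed_segment c d. n \<bullet> x > \<beta>"
    using separating_hyperplane_compact_closed[of "closed_segment a b" "closed_segment c d"] assms
    by auto
  then have "n \<bullet> a < \<beta>" "n \<bullet> b < \<beta>" "n \<bullet> c > \<beta>" "n \<bullet> d > \<beta>" by auto
  then have "n \<bullet> (y - x) > 0" if "x \<in> {a, b}" "y \<in> {c, d}" for x y
    using that by (auto simp: inner_diff_right)
  then show ?thesis
    using turn_trans_halfplane[of n "c - a" "d - a" "d - b"] turn_trans_halfplane[of n "c - a" "c - b" "d - b"]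
    by simp
qed

text \<open>A turn by exactly pi sends the second segment back over the first. On a simple arc this
  is impossible, which rules out the angle whose sense of rotation would be ambiguous.\<close>

lemma antiparallel_segments_meet:
  assumes "Arg ((c - b) / (b - a)) = pi" "a \<noteq> b" 
  shows "\<exists>x. x \<noteq> b \<and> x \<in> closed_segment a b \<inter> closed_segment b c"
proof -
  from assms(1) have "Re ((c - b) / (b - a)) < 0" "Im ((c - b) / (b - a)) = 0"
    by (auto simp: Arg_eq_pi)
  then obtain r :: real where r: "r > 0" "(c - b) / (b - a) = - of_real r"
    by (metis complex_eq_iff complex_of_real_def minus_complex.simps neg_0_less_iff_less Re_complex_of_real Im_complex_of_real uminus_complex.sel add.inverse_inverse of_real_minus)
  then have c: "c = b - r *\<^sub>R (b - a)" using assms(2) 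
    by (simp add: field_simps scaleR_conv_of_real)
  \<comment> \<open>Going back from \<open>b\<close> by the shorter of the two lengths, in units of
    \<open>b - a\<close>, stays on both segments.\<close>
  define t where "t = min r 1"
  have t: "0 < t" "t \<le> 1" "0 < t / r" "t / r \<le> 1" using r by (auto simp: t_def)
  have "b - t *\<^sub>R (b - a) = (1 - (1 - t)) *\<^sub>R a + (1 - t) *\<^sub>R b"
    by (simp add: algebra_simps)
  then have "b - t *\<^sub>R (b - a) \<in> closed_segment a b"
    unfolding in_segment using t by (intro exI[of _ "1 - t"]) auto
  moreover have "b - t *\<^sub>R (b - a) = (1 - t / r) *\<^sub>R b + (t / r) *\<^sub>R c"
    unfolding c using r by (simp add: algebra_simps)
  then have "b - t *\<^sub>R (b - a) \<in> closed_segment b c"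
    unfolding in_segment using t by (intro exI[of _ "t / r"] conjI) (assumption | linarith)+
  moreover have "b - t *\<^sub>R (b - a) \<noteq> b" using t assms(2) by simp
  ultimately show ?thesis by blast
qed

text \<open>Divided by \<open>b - a\<close>, the three secants become \<open>1\<close>,
  \<open>1 + q\<close> and \<open>q\<close>. They lie in a common open half plane because
  \<open>q\<close> is not a negative real.\<close>

lemma turn_triangle:
  assumes "closed_segment a b \<inter> closed_segment b c \<subseteq> {b}" "a \<noteq> b" "b \<noteq> c"
  shows "turn (b - a) (c - a) + turn (c - a) (c - b) = turn (b - a) (c - b)"
proof -
  define q where "q = (c - b) / (b - a)"
  have q: "q \<noteq> 0" "Arg q \<noteq> pi" 
    using antiparallel_segments_meet[of c b a] assms by (auto simp: q_def)
  \<comment> \<open>The bisector of the angle: all three vectors lie strictly on its side.\<close>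
  define h where "h = cis (Arg q / 2)"
  have "- (pi / 2) < Arg q / 2 \<and> Arg q / 2 < pi / 2" using q Arg_bounded[of q] by auto
  then have cp: "cos (Arg q / 2) > 0" by (intro cos_gt_zero_pi) auto
  have qe: "q = of_real (cmod q) * (h * h)"
    using rcis_cmod_Arg[of q] by (simp add: h_def cis_mult rcis_def)
  have hh: "h \<bullet> h = 1" by (simp add: h_def inner_complex_def flip: power2_eq_square)
  have "h \<bullet> (h * h) = Re h" 
  proof -
    have "h \<bullet> (h * h) = Re h * (h \<bullet> h)" by (simp add: inner_complex_def algebra_simps)
    then show ?thesis using hh by simp
  qed
  then have "h \<bullet> q = cmod q * Re h" 
    using inner_scaleR_right[of h "cmod q" "h * h"] qe by (simp add: scaleR_conv_of_real)
  then have hq: "h \<bullet> q > 0" using cp q by (simp add: h_def)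
  moreover have h1: "h \<bullet> 1 > 0" using cp by (simp add: h_def inner_complex_def)
  ultimately have "turn 1 (1 + q) + turn (1 + q) q = turn 1 q"
    by (intro turn_trans_halfplane[of h]) (auto simp: inner_add_right)
  moreover have "(c - a) / (b - a) = 1 + q" "(c - b) / (c - a) = q / (1 + q)"
  proof -
    show 1: "(c - a) / (b - a) = 1 + q" using assms by (simp add: q_def field_simps)
    have "(c - b) / (c - a) = ((c - b) / (b - a)) / ((c - a) / (b - a))" using assms by simp
    then show "(c - b) / (c - a) = q / (1 + q)" unfolding 1 by (simp add: q_def)
  qed
  ultimately show ?thesis by (simp only: turn_def q_def[symmetric] div_by_1)
qed

text \<open>The discrete form of Hopf's proof of the rotation theorem (Umlaufsatz): the secants
  \<open>p j - p i\<close> of a simple polygonal arc turn the same way along the diagonal \<open>j = i + 1\<close>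
  and along the two legs of the triangle of all pairs \<open>i < j\<close>.\<close>

definition simple_arc :: "nat \<Rightarrow> (nat \<Rightarrow> complex) \<Rightarrow> bool" where
  "simple_arc n p \<longleftrightarrow>
     (\<forall>i<n. p i \<noteq> p (Suc i)) \<and>
     (\<forall>i. Suc i < n \<longrightarrow> closed_segment (p i) (p (Suc i)) \<inter> closed_segment (p (Suc i)) (p (i + 2)) \<subseteq> {p (Suc i)}) \<and>
     (\<forall>i j. Suc i < j \<and> j < n \<longrightarrow> closed_segment (p i) (p (Suc i)) \<inter> closed_segment (p j) (p (Suc j)) = {})"

text \<open>Exchanges the secants from \<open>p 0\<close> for those from \<open>p 1\<close>. The
  induction starts with the triangle on the first three points; each further point adds the square
  formed by the first edge and the newest edge.\<close>

lemma turn_row: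
  assumes "simple_arc (n + 2) p"
  shows "(\<Sum>k<Suc n. turn (p (k + 1) - p 0) (p (k + 2) - p 0)) + turn (p (n + 2) - p 0) (p (n + 2) - p 1) =
    turn (p 1 - p 0) (p 2 - p 1) + (\<Sum>k<n. turn (p (k + 2) - p 1) (p (k + 3) - p 1))"
  using assms
proof (induction n)
  case 0
  then show ?case
    using turn_triangle[of "p 0" "p 1" "p 2"] by (auto simp: simple_arc_def numeral_2_eq_2 less_Suc_eq)
next
  case (Suc n)
  have "simple_arc (n + 2) p" using Suc.prems by (auto simp: simple_arc_def)
  note IH = Suc.IH[OF this]
  have "closed_segment (p 0) (p 1) \<inter> closed_segment (p (n + 2)) (p (n + 3)) = {}"
    using Suc.prems unfolding simple_arc_def
    by (auto dest!: spec[of _ 0] spec[of _ "n + 2"] simp: numeral_3_eq_3 numeral_2_eq_2)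
  note turn_square[OF this]
  with IH show ?case by (simp add: numeral_3_eq_3 numeral_2_eq_2)
qed

text \<open>Peel off \<open>p 0\<close>: the induction hypothesis treats the arc from
  \<open>p 1\<close> on, and \<open>turn_row\<close> moves its first leg back to
  \<open>p 0\<close>.\<close>

lemma hopf_turning:
  assumes "simple_arc (Suc n) p"
  shows "(\<Sum>k<n. turn (p (k + 1) - p k) (p (k + 2) - p (k + 1))) =
    (\<Sum>k<n. turn (p (k + 1) - p 0) (p (k + 2) - p 0)) +
    (\<Sum>k<n. turn (p (n + 1) - p k) (p (n + 1) - p (k + 1)))"
  using assms
proof (induction n arbitrary: p)
  case 0
  then show ?case by simp
next
  case (Suc n)
  have "simple_arc (Suc n) (p \<circ> Suc)"
    using Suc.prems unfolding simple_arc_def by (auto simp: less_diff_conv)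
  from Suc.IH[OF this] 
  have IH: "(\<Sum>k<n. turn (p (k + 2) - p (k + 1)) (p (k + 3) - p (k + 2))) =
    (\<Sum>k<n. turn (p (k + 2) - p 1) (p (k + 3) - p 1)) +
    (\<Sum>k<n. turn (p (n + 2) - p (k + 1)) (p (n + 2) - p (k + 2)))"
    by (simp add: numeral_3_eq_3 numeral_2_eq_2)
  have "simple_arc (n + 2) p" using Suc.prems by simp
  note row = turn_row[OF this]
  have "(\<Sum>k<Suc n. turn (p (k + 1) - p k) (p (k + 2) - p (k + 1))) =
     turn (p 1 - p 0) (p 2 - p 1) + (\<Sum>k<n. turn (p (k + 2) - p (k + 1)) (p (k + 3) - p (k + 2)))"
    by (simp only: sum.lessThan_Suc_shift) (simp add: numeral_3_eq_3 numeral_2_eq_2)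
  moreover have "(\<Sum>k<Suc n. turn (p (Suc n + 1) - p k) (p (Suc n + 1) - p (k + 1))) =
     turn (p (n + 2) - p 0) (p (n + 2) - p 1) + (\<Sum>k<n. turn (p (n + 2) - p (k + 1)) (p (n + 2) - p (k + 2)))"
    by (simp only: sum.lessThan_Suc_shift) (simp add: numeral_3_eq_3 numeral_2_eq_2)
  ultimately show ?case using IH row by linarith
qed

text \<open>Secants from the first point stay on the side of \<open>d\<close>, and secants to the
  last point on the side of \<open>- d\<close>. Each turn is thus a difference of angles, and both
  legs of \<open>hopf_turning\<close> telescope.\<close>

lemma turning_in_halfplane:
  assumes "simple_arc (Suc n) p" "d \<bullet> p 0 = c" "d \<bullet> p (Suc n) = c" "p 0 \<noteq> p (Suc n)"
    and "\<And>k. 0 < k \<Longrightarrow> k \<le> n \<Longrightarrow> d \<bullet> p k > c"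
  shows "(\<Sum>k<n. turn (p (k + 1) - p k) (p (k + 2) - p (k + 1))) =
    Arg ((p (Suc n) - p 0) / d) - Arg ((p 1 - p 0) / d) +
    Arg ((p (Suc n) - p n) / - d) - Arg ((p (Suc n) - p 0) / - d)"
proof -
  have 1: "turn (p (k + 1) - p 0) (p (k + 2) - p 0) =
      Arg ((p (Suc (Suc k)) - p 0) / d) - Arg ((p (Suc k) - p 0) / d)" if "k < n" for k
  proof -
    have "d \<bullet> p (k + 1) > c" using assms(5)[of "k + 1"] that by auto
    \<comment> \<open>For the last index this secant is the chord, which lies on the bounding line;
      \<open>turn_halfplane\<close> allows this for one of its two vectors.\<close>
    moreover have "d \<bullet> p (k + 2) \<ge> c \<and> p (k + 2) \<noteq> p 0"
    proof (cases "k + 2 = Suc n")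
      case False
      then show ?thesis using assms(5)[of "k + 2"] assms(2) that by auto
    qed (use assms in auto)
    ultimately show ?thesis using assms(2) turn_halfplane(1)[of d "p (k+1) - p 0" "p (k+2) - p 0"]
      by (simp add: inner_diff_right)
  qed
  have 2: "turn (p (n + 1) - p k) (p (n + 1) - p (k + 1)) =
      Arg ((p (Suc n) - p (Suc k)) / - d) - Arg ((p (Suc n) - p k) / - d)" if "k < n" for k
  proof -
    have "d \<bullet> p (k + 1) > c" using assms(5)[of "k + 1"] that by auto
    \<comment> \<open>Here the chord occurs at the first index instead.\<close>
    moreover have "d \<bullet> p k \<ge> c \<and> p k \<noteq> p (Suc n)"
    proof (cases "k = 0")
      case False
      then show ?thesis using assms(5)[of k] assms(3) that by auto
    qed (use assms in auto)
    ultimately show ?thesis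
      using assms(3) turn_halfplane(2)[of "- d" "p (n + 1) - p (k + 1)" "p (n + 1) - p k"]
      by (auto simp: inner_diff_right)
  qed
  show ?thesis
    unfolding hopf_turning[OF assms(1)]
    using sum_lessThan_telescope[of "\<lambda>k. Arg ((p (Suc k) - p 0) / d)" n]
      sum_lessThan_telescope[of "\<lambda>k. Arg ((p (Suc n) - p k) / - d)" n] 1 2
    by simp
qed


section \<open>Directed paths\<close>

definition edge_path :: "('n, 'z) plabic_graph_scheme \<Rightarrow> (complex \<times> complex) list \<Rightarrow> bool" where
  "edge_path G P \<longleftrightarrow> P \<noteq> [] \<and> set P \<subseteq> edges G \<and> successively (\<lambda>e f. snd e = fst f) P"

text \<open>A path with \<open>n\<close> edges has the vertices \<open>0\<close> to
  \<open>n\<close>; the default case supplies the final one, so that the vertex sequence can serve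
  as a \<open>simple_arc\<close>.\<close>

definition node :: "(complex \<times> complex) list \<Rightarrow> nat \<Rightarrow> complex" where
  "node P k = (if k < length P then fst (P ! k) else snd (last P))"

lemma directed_paths_eq:
  "directed_paths G e j = {P. edge_path G P \<and> hd P = e \<and> snd (last P) = bdry G j}"
  by (auto simp: directed_paths_def edge_path_def successively_conv_nth)

lemma nth_eq_node:
  assumes "edge_path G P" "k < length P"
  shows "P ! k = (node P k, node P (Suc k))"
proof (cases "Suc k < length P")
  case True
  then show ?thesis
    using assms by (auto simp: node_def edge_path_def successively_conv_nth prod_eq_iff)
next
  case False
  then have "k = length P - 1" using assms by simp
  then show ?thesis
    using assms by (auto simp: node_def edge_path_def last_conv_nth prod_eq_iff)
qed

lemma node_edge:
  assumes "edge_path G P" "k < length P"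
  shows "(node P k, node P (Suc k)) \<in> edges G"
  using assms nth_eq_node[OF assms] nth_mem[OF assms(2)] by (auto simp: edge_path_def)

lemma hd_eq_node: "edge_path G P \<Longrightarrow> hd P = (node P 0, node P 1)"
  using nth_eq_node[of G P 0] by (auto simp: edge_path_def hd_conv_nth)

lemma last_eq_node: "edge_path G P \<Longrightarrow> length P = Suc n \<Longrightarrow> last P = (node P n, node P (Suc n))"
  using nth_eq_node[of G P n] by (auto simp: edge_path_def last_conv_nth)

lemma node_trancl:
  assumes "edge_path G P" "i < j" "j \<le> length P"
  shows "(node P i, node P j) \<in> (edges G)\<^sup>+"
  using assms(2,3)
proof (induction j)
  case (Suc j)
  have "(node P j, node P (Suc j)) \<in> edges G" using node_edge[OF assms(1), of j] Suc.prems by auto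
  then show ?case using Suc by (cases "i = j") (auto intro: trancl_into_trancl)
qed simp

text \<open>Winding lives on pairs of consecutive edges, so a path is cut at an edge that belongs to
  both pieces.\<close>

lemma path_wind_append:
  "path_wind l (Q @ e # P) = path_wind l (Q @ [e]) + path_wind l (e # P)"
proof -
  have wcons: "path_wind l (x # y # zs) = wind_pair l x y + path_wind l (y # zs)" for x y zs
    unfolding path_wind_def by (simp add: sum.lessThan_Suc_shift del: sum.lessThan_Suc)
  have wnil: "path_wind l [x] = 0" for x by (simp add: path_wind_def)
  show ?thesis
  proof (induction Q)
    case (Cons x Q)
    then show ?case using Cons.IH by (cases Q) (simp_all add: wcons wnil)
  qed (simp add: wnil)
qed

lemma even_card_sym_diff:
  assumes "finite A" "finite B"
  shows "even (card ((A - B) \<union> (B - A))) \<longleftrightarrow> (even (card A) \<longleftrightarrow> even (card B))"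
proof -
  have "card ((A - B) \<union> (B - A)) = card (A - B) + card (B - A)"
    using assms by (intro card_Un_disjoint) auto
  moreover have "card A = card (A - B) + card (A \<inter> B)" "card B = card (B - A) + card (A \<inter> B)"
    using assms by (subst card_Un_disjoint[symmetric]; auto intro: arg_cong[where f = card])+
  ultimately show ?thesis by auto
qed

text \<open>Along the segment \<open>h\<close> is a nonconstant affine function of one parameter.
  Convexity keeps its sign when the end signs agree, and nonconstancy makes a zero unique.\<close>

lemma segment_meets_level_zero_iff:
  fixes h :: "complex \<Rightarrow> real"
  assumes "h u \<noteq> 0" "h v \<noteq> 0" "h u \<noteq> h v"
    and affine: "\<And>s. h ((1 - s) *\<^sub>R u + s *\<^sub>R v) = (1 - s) * h u + s * h v"
  shows "(\<exists>x\<in>closed_segment u v. h x = 0) \<longleftrightarrow> (h u < 0) \<noteq> (h v < 0)"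
    and "x \<in> closed_segment u v \<Longrightarrow> y \<in> closed_segment u v \<Longrightarrow> h x = 0 \<Longrightarrow> h y = 0 \<Longrightarrow> x = y"
proof -
  show "(\<exists>x\<in>closed_segment u v. h x = 0) \<longleftrightarrow> (h u < 0) \<noteq> (h v < 0)"
  proof
    assume "\<exists>x\<in>closed_segment u v. h x = 0"
    then obtain s where s: "0 \<le> s" "s \<le> 1" "(1 - s) * h u + s * h v = 0"
      by (auto simp: in_segment affine)
    show "(h u < 0) \<noteq> (h v < 0)"
    proof (rule ccontr)
      assume "\<not> ?thesis"
      then consider "h u < 0" "h v < 0" | "h u > 0" "h v > 0" using assms by force
      then show False
        using s convex_bound_lt[of "h u" 0 "h v" "1 - s" s] convex_bound_lt[of "- h u" 0 "- h v" "1 - s" s]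
        by cases (auto simp: algebra_simps)
    qed
  next
    assume *: "(h u < 0) \<noteq> (h v < 0)"
    \<comment> \<open>The root of \<open>(1 - s) * h u + s * h v\<close>.\<close>
    define s where "s = h u / (h u - h v)"
    have "0 \<le> s" "s \<le> 1" using * assms by (auto simp: s_def field_simps)
    moreover have "(1 - s) * h u + s * h v = 0" using assms by (simp add: s_def field_simps)
    ultimately show "\<exists>x\<in>closed_segment u v. h x = 0"
      by (intro bexI[of _ "(1 - s) *\<^sub>R u + s *\<^sub>R v"]) (auto simp: affine in_segment)
  qed
  assume "x \<in> closed_segment u v" "y \<in> closed_segment u v" "h x = 0" "h y = 0"
  then obtain s t where st: "x = (1 - s) *\<^sub>R u + s *\<^sub>R v" "y = (1 - t) *\<^sub>R u + t *\<^sub>R v"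
    "(1 - s) * h u + s * h v = 0" "(1 - t) * h u + t * h v = 0"
    by (auto simp: in_segment affine)
  then have "s * (h u - h v) = t * (h u - h v)" by (simp add: algebra_simps)
  then show "x = y" using st assms by simp
qed

section \<open>Plabic graphs with a gauge ray direction\<close>

locale gauged_plabic =
  fixes G :: "('n::{finite,linorder}, 'z) plabic_graph_scheme" and l :: complex
  assumes plabic: "plabic_graph G"
    and gauge: "gauge_ray_direction G l"
begin

lemma edgeD:
  assumes "(u, v) \<in> edges G"
  shows "u \<noteq> v" "u \<in> vertices G" "v \<in> vertices G" "orient (v - u) l \<noteq> 0"
  using plabic gauge assms
  unfolding plabic_graph_def straight_planar_def gauge_ray_direction_def by blast+

lemma finite_edges: "finite (edges G)"
proof -
  have "finite (vertices G)" "edges G \<subseteq> vertices G \<times> vertices G"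
    using plabic by (auto simp: plabic_graph_def straight_planar_def vertices_def)
  then show ?thesis by (meson finite_SigmaI finite_subset)
qed

lemma inner_interior: "x \<in> inner G \<Longrightarrow> x \<in> interior (disk G)"
  using plabic by (auto simp: plabic_graph_def straight_planar_def)

lemma edges_meet:
  assumes "(u, v) \<in> edges G" "(u', v') \<in> edges G" "(u, v) \<noteq> (u', v')"
  shows "closed_segment u v \<inter> closed_segment u' v' \<subseteq> {u, v} \<inter> {u', v'}"
proof -
  have "\<forall>(u, v)\<in>edges G. \<forall>(u', v')\<in>edges G. (u, v) \<noteq> (u', v') \<longrightarrow>
      closed_segment u v \<inter> closed_segment u' v' \<subseteq> {u, v} \<inter> {u', v'}"
    using plabic by (simp add: plabic_graph_def straight_planar_def)
  from bspec[OF bspec[OF this assms(1), simplified] assms(2)] assms(3) show ?thesis by simp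
qed

lemma bdry_edge_unique:
  assumes "e \<in> edges G" "f \<in> edges G" "bdry G i \<in> {fst e, snd e}" "bdry G i \<in> {fst f, snd f}"
  shows "e = f"
proof -
  have "degree_at G (bdry G i) = 1" using plabic by (simp add: plabic_graph_def)
  then obtain g where "{e \<in> edges G. fst e = bdry G i \<or> snd e = bdry G i} = {g}"
    unfolding degree_at_def by (rule card_1_singletonE)
  moreover have "e \<in> {e \<in> edges G. fst e = bdry G i \<or> snd e = bdry G i}"
    "f \<in> {e \<in> edges G. fst e = bdry G i \<or> snd e = bdry G i}"
    using assms by auto
  ultimately show ?thesis by simp
qed

lemma bdry_not_passed: "(u, bdry G i) \<in> edges G \<Longrightarrow> (bdry G i, v) \<notin> edges G"
  using bdry_edge_unique[of "(u, bdry G i)" "(bdry G i, v)" i] edgeD(1) by auto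

text \<open>\<open>d\<close> is the inward normal of the segment that carries the boundary vertices.
  The gauge direction points to the same side, since short pieces of the rays lie inside the
  disk.\<close>

lemma halfplane:
  obtains d c where "\<And>x. x \<in> interior (disk G) \<Longrightarrow> d \<bullet> x > c" "\<And>i. d \<bullet> bdry G i = c" "d \<bullet> l > 0"
proof -
  obtain p q and t :: "'n \<Rightarrow> real" where pq: "p \<noteq> q"
    "\<And>x. x \<in> disk G \<Longrightarrow> orient (q - p) (x - p) \<le> 0" "\<And>i. bdry G i = p + t i *\<^sub>R (q - p)"
    using plabic unfolding plabic_graph_def bdry_on_segment_def by blast
  \<comment> \<open>\<open>q - p\<close> turned clockwise by a right angle, towards the
    disk.\<close>
  define d where "d = - \<i> * (q - p)"
  have d: "d \<noteq> 0" using pq by (simp add: d_def)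
  have dx: "d \<bullet> (x - p) = - Im (cnj (q - p) * (x - p))" for x
    by (simp add: d_def inner_complex_def algebra_simps)
  have ge: "d \<bullet> x \<ge> d \<bullet> p" if "x \<in> disk G" for x
    using pq(2)[OF that] dx[of x] by (auto simp: orient_def inner_diff_right split: if_splits)
  have gt: "d \<bullet> x > d \<bullet> p" if x: "x \<in> interior (disk G)" for x
  proof -
    obtain r where r: "r > 0" "cball x r \<subseteq> disk G" using x by (auto simp: mem_interior_cball)
    \<comment> \<open>From an interior point one can still move a little against \<open>d\<close>
      inside the disk, which makes the inequality strict.\<close>
    have "x - (r / norm d) *\<^sub>R d \<in> cball x r" using r d by (simp add: dist_norm)
    then have "d \<bullet> (x - (r / norm d) *\<^sub>R d) \<ge> d \<bullet> p" using ge r by blast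
    moreover have "r / norm d * (d \<bullet> d) > 0" using r d by simp
    ultimately show ?thesis by (simp add: inner_diff_right)
  qed
  have b: "d \<bullet> bdry G i = d \<bullet> p" for i
    by (simp add: pq(3) inner_add_right d_def) (simp add: inner_complex_def algebra_simps)
  \<comment> \<open>Any boundary vertex will do, hence the arbitrary label
    \<open>undefined\<close>.\<close>
  obtain r where r: "r > 0" "\<And>t. 0 < t \<Longrightarrow> t < r \<Longrightarrow> bdry G undefined + t *\<^sub>R l \<in> interior (disk G)"
    using gauge unfolding gauge_ray_direction_def by blast
  have "d \<bullet> (bdry G undefined + (r / 2) *\<^sub>R l) > d \<bullet> p" using r by (intro gt) auto
  then have "d \<bullet> l > 0" using b[of undefined] r by (simp add: inner_add_right zero_less_mult_iff)
  with gt b show ?thesis using that by blast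
qed

lemma bdry_notin_inner: "bdry G i \<notin> inner G"
  using halfplane inner_interior by (metis less_irrefl)

end

section \<open>Winding of directed paths in acyclic networks\<close>

locale acyclic_plabic = gauged_plabic G l
  for G :: "('n::{finite,linorder}, 'z) plabic_graph_scheme" and l +
  assumes acyclic: "acyclic (edges G)"
begin

lemma node_distinct:
  assumes "edge_path G P" "i \<le> length P" "j \<le> length P" "i \<noteq> j"
  shows "node P i \<noteq> node P j"
  using assms node_trancl[OF assms(1), of i j] node_trancl[OF assms(1), of j i] acyclic
  by (metis acyclic_def linorder_neqE_nat)

text \<open>A boundary vertex has degree one, so a path cannot pass through it.\<close>

lemma node_inner:
  assumes "edge_path G P" "0 < k" "k < length P"
  shows "node P k \<in> inner G"
proof -
  obtain k' where k: "k = Suc k'" using assms(2) by (cases k) auto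
  have "(node P k', node P k) \<in> edges G" "(node P k, node P (Suc k)) \<in> edges G"
    using node_edge[OF assms(1)] assms(3) k by auto
  moreover from this(2) have "node P k \<in> vertices G" by (rule edgeD(2))
  ultimately show ?thesis using bdry_not_passed by (auto simp: vertices_def)
qed

text \<open>Acyclicity makes the vertices distinct; planarity then lets edges meet only at the
  vertices they share.\<close>

lemma simple_arc_node:
  assumes P: "edge_path G P" and n: "length P = n"
  shows "simple_arc n (node P)"
proof -
  note ne = node_distinct[OF P, unfolded n]
  note ed = node_edge[OF P, unfolded n]
  have meet: "closed_segment (node P i) (node P (Suc i)) \<inter> closed_segment (node P j) (node P (Suc j))
      \<subseteq> {node P i, node P (Suc i)} \<inter> {node P j, node P (Suc j)}" if "i < j" "j < n" for i j
    using that ne[of i j] by (intro edges_meet ed) auto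
  show ?thesis
    unfolding simple_arc_def
  proof (intro conjI allI impI)
    fix i assume "i < n" then show "node P i \<noteq> node P (Suc i)" using ne by auto
  next
    fix i assume i: "Suc i < n"
    then have "node P i \<noteq> node P (Suc i)" "node P i \<noteq> node P (i + 2)" using ne by auto
    then show "closed_segment (node P i) (node P (Suc i)) \<inter>
        closed_segment (node P (Suc i)) (node P (i + 2)) \<subseteq> {node P (Suc i)}"
      using meet[of i "Suc i"] i by auto
  next
    fix i j assume ij: "Suc i < j \<and> j < n"
    then have "{node P i, node P (Suc i)} \<inter> {node P j, node P (Suc j)} = {}" using ne by auto
    then show "closed_segment (node P i) (node P (Suc i)) \<inter> closed_segment (node P j) (node P (Suc j)) = {}"
      using meet[of i j] ij by auto
  qed
qed

text \<open>Summing \<open>wind_pair_eq_turn\<close> along the path, the angles with branch cut at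
  \<open>l\<close> telescope, leaving the total turning and a term from the first and last
  edges.\<close>

lemma path_wind_eq_turning:
  assumes P: "edge_path G P" and n: "length P = Suc n"
  defines "p \<equiv> node P"
  shows "2 * pi * of_int (path_wind l P) =
    (\<Sum>k<n. turn (p (k + 1) - p k) (p (k + 2) - p (k + 1))) +
    Arg (- (p 1 - p 0) / l) - Arg (- (p (Suc n) - p n) / l)"
proof -
  define \<psi> where "\<psi> k = Arg (- (p (Suc k) - p k) / l)" for k
  have arc: "simple_arc (Suc n) p" using simple_arc_node[OF P n] by (simp add: p_def)
  have step: "2 * pi * of_int (wind_pair l (P ! k) (P ! Suc k)) =
      turn (p (k + 1) - p k) (p (k + 2) - p (k + 1)) + (\<psi> k - \<psi> (Suc k))" if k: "k < n" for k
  proof -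
    have e: "P ! k = (p k, p (Suc k))" "P ! Suc k = (p (Suc k), p (Suc (Suc k)))"
      using nth_eq_node[OF P] n k by (auto simp: p_def)
    have "(p k, p (Suc k)) \<in> edges G" "(p (Suc k), p (Suc (Suc k))) \<in> edges G"
      using node_edge[OF P] n k by (auto simp: p_def)
    then have o: "orient (p (Suc k) - p k) l \<noteq> 0" "orient (p (Suc (Suc k)) - p (Suc k)) l \<noteq> 0"
      using edgeD(4) by auto
    have "p k \<noteq> p (Suc k)"
      "closed_segment (p k) (p (Suc k)) \<inter> closed_segment (p (Suc k)) (p (Suc (Suc k))) \<subseteq> {p (Suc k)}"
      using arc k by (auto simp: simple_arc_def)
    \<comment> \<open>Consecutive edges share only one point, so no half turn occurs.\<close>
    then have "Arg ((p (Suc (Suc k)) - p (Suc k)) / (p (Suc k) - p k)) \<noteq> pi"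
      using antiparallel_segments_meet[of "p (Suc (Suc k))" "p (Suc k)" "p k"] by blast
    from wind_pair_eq_turn[OF o this, of "P ! k" "P ! Suc k"] show ?thesis
      by (simp add: e \<psi>_def)
  qed
  have "2 * pi * of_int (path_wind l P) = (\<Sum>k<n. 2 * pi * of_int (wind_pair l (P ! k) (P ! Suc k)))"
    by (simp add: path_wind_def n sum_distrib_left)
  also have "\<dots> = (\<Sum>k<n. turn (p (k + 1) - p k) (p (k + 2) - p (k + 1))) + (\<Sum>k<n. \<psi> k - \<psi> (Suc k))"
    using step by (simp add: sum.distrib)
  also have "(\<Sum>k<n. \<psi> k - \<psi> (Suc k)) = \<psi> 0 - \<psi> n"
    by (rule sum_lessThan_telescope')
  finally show ?thesis by (simp add: \<psi>_def)
qed

text \<open>Interior vertices lie strictly on one side of the boundary line, so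
  \<open>turning_in_halfplane\<close> expresses the turning by the first and last edges
  alone.\<close>

lemma path_wind_unique:
  assumes "edge_path G P" "edge_path G P'" "hd P = hd P'" "last P = last P'"
    and "fst (hd P) = bdry G i" "snd (last P) = bdry G j"
  shows "path_wind l P = path_wind l P'"
proof -
  obtain d c where dc: "\<And>x. x \<in> interior (disk G) \<Longrightarrow> d \<bullet> x > c" "\<And>i. d \<bullet> bdry G i = c"
    using halfplane by metis
  \<comment> \<open>The right-hand side mentions only the end edges of \<open>P\<close>, so it is
    the same number for \<open>P\<close> and for \<open>P'\<close>.\<close>
  have "2 * pi * of_int (path_wind l Q) =
      Arg ((bdry G j - bdry G i) / d) - Arg ((snd (hd P) - bdry G i) / d) +
      Arg ((bdry G j - fst (last P)) / - d) - Arg ((bdry G j - bdry G i) / - d) +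
      Arg (- (snd (hd P) - bdry G i) / l) - Arg (- (bdry G j - fst (last P)) / l)"
    if Q: "edge_path G Q" "hd Q = hd P" "last Q = last P" for Q
  proof -
    obtain n where n: "length Q = Suc n" using Q(1) by (cases Q) (auto simp: edge_path_def)
    have hd: "hd P = (node Q 0, node Q 1)" "last P = (node Q n, node Q (Suc n))"
      using hd_eq_node[OF Q(1)] last_eq_node[OF Q(1) n] Q by auto
    then have ij: "bdry G i = node Q 0" "bdry G j = node Q (Suc n)"
      using assms(5,6) by auto
    have "(\<Sum>k<n. turn (node Q (k + 1) - node Q k) (node Q (k + 2) - node Q (k + 1))) =
      Arg ((node Q (Suc n) - node Q 0) / d) - Arg ((node Q 1 - node Q 0) / d) +
      Arg ((node Q (Suc n) - node Q n) / - d) - Arg ((node Q (Suc n) - node Q 0) / - d)"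
    proof (rule turning_in_halfplane)
      show "simple_arc (Suc n) (node Q)" using simple_arc_node[OF Q(1) n] .
      show "d \<bullet> node Q 0 = c" "d \<bullet> node Q (Suc n) = c" using dc(2) by (simp_all flip: ij)
      show "node Q 0 \<noteq> node Q (Suc n)" using node_distinct[OF Q(1)] n by simp
      show "d \<bullet> node Q k > c" if "0 < k" "k \<le> n" for k
        using dc(1) inner_interior node_inner[OF Q(1)] that n by simp
    qed
    with path_wind_eq_turning[OF Q(1) n] show ?thesis by (simp add: hd ij)
  qed
  from this[of P] this[of P'] assms have "2 * pi * of_int (path_wind l P) = 2 * pi * of_int (path_wind l P')"
    by simp
  then show ?thesis by simp
qed

text \<open>Follow incoming edges backwards. In a finite acyclic graph this stops, and without
  internal sources it can stop only at the boundary.\<close>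

lemma path_from_bdry:
  assumes "internal_sources G = {}" "(u, v) \<in> edges G"
  shows "\<exists>Q i. edge_path G (Q @ [(u, v)]) \<and> fst (hd (Q @ [(u, v)])) = bdry G i"
proof -
  have "wf (edges G)" using finite_acyclic_wf finite_edges acyclic by blast
  then show ?thesis using assms(2)
  proof (induction u arbitrary: v rule: wf_induct_rule)
    case (less u)
    show ?case
    proof (cases "u \<in> inner G")
      case True
      then obtain w where w: "(w, u) \<in> edges G" using assms(1) by (auto simp: internal_sources_def)
      from less.IH[OF w w] obtain Q i where "edge_path G (Q @ [(w, u)])" "fst (hd (Q @ [(w, u)])) = bdry G i"
        by blast
      then have "edge_path G ((Q @ [(w, u)]) @ [(u, v)])" "fst (hd ((Q @ [(w, u)]) @ [(u, v)])) = bdry G i"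
        using less.prems by (auto simp: edge_path_def successively_append_iff hd_append)
      then show ?thesis by blast
    next
      case False
      then obtain i where "u = bdry G i" using edgeD(2)[OF less.prems] by (auto simp: vertices_def)
      then show ?thesis using less.prems by (intro exI[of _ "[]"] exI[of _ i]) (auto simp: edge_path_def)
    qed
  qed
qed

lemma last_unique:
  assumes "P \<in> directed_paths G e j" "P' \<in> directed_paths G e' j"
  shows "last P = last P'"
proof -
  have "last P \<in> edges G" "last P' \<in> edges G" "snd (last P) = bdry G j" "snd (last P') = bdry G j"
    using assms by (auto simp: directed_paths_def)
  then show ?thesis by (intro bdry_edge_unique[of _ _ j]) auto
qed

text \<open>Prepending one common path from the boundary reduces this to
  \<open>path_wind_unique\<close>; the winding of the common part then cancels.\<close>

lemma directed_paths_wind_eq: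
  assumes "internal_sources G = {}" "P \<in> directed_paths G e j" "P' \<in> directed_paths G e j"
  shows "path_wind l P = path_wind l P'"
proof -
  obtain R R' where R: "P = e # R" "P' = e # R'"
    using assms(2,3) by (cases P; cases P'; auto simp: directed_paths_def)
  have P: "edge_path G P" "edge_path G P'" "snd (last P) = bdry G j" "last P = last P'"
    using assms(2,3) last_unique[OF assms(2,3)] by (auto simp: directed_paths_eq)
  have "e \<in> edges G" using P R by (auto simp: edge_path_def)
  then obtain Q i where Q: "edge_path G (Q @ [e])" "fst (hd (Q @ [e])) = bdry G i"
    using path_from_bdry[OF assms(1), of "fst e" "snd e"] by auto
  have "edge_path G (Q @ P)" "edge_path G (Q @ P')"
    using P Q R by (auto simp: edge_path_def successively_append_iff)
  then have "path_wind l (Q @ P) = path_wind l (Q @ P')"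
    by (rule path_wind_unique) (use P Q R in \<open>auto simp: hd_append\<close>)
  then show ?thesis using path_wind_append[of l Q e R] path_wind_append[of l Q e R'] R by simp
qed

section \<open>Parity of the intersections with the gauge rays\<close>

text \<open>Up to the factor \<open>cmod l\<close>, the signed distance from the line through the
  gauge ray at \<open>bdry G i\<close>, positive on its left.\<close>

definition height :: "'n \<Rightarrow> complex \<Rightarrow> real" where
  "height i x = Im (cnj l * (x - bdry G i))"

text \<open>Counts the gauge lines that have \<open>x\<close> on their right. Its parity is a
  potential for crossing numbers.\<close>

definition below :: "complex \<Rightarrow> nat" where
  "below x = card {i \<in> sources G. height i x < 0}"

text \<open>Inside the disk the line through a gauge ray reduces to the ray, since its backward half
  leaves the half plane of the disk.\<close>

lemma on_ray_iff:
  assumes "x \<in> interior (disk G)"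
  shows "height i x = 0 \<longleftrightarrow> (\<exists>t>0. x = bdry G i + t *\<^sub>R l)"
proof
  assume "\<exists>t>0. x = bdry G i + t *\<^sub>R l"
  then show "height i x = 0" by (auto simp: height_def algebra_simps)
next
  assume h: "height i x = 0"
  obtain d c where dc: "\<And>x. x \<in> interior (disk G) \<Longrightarrow> d \<bullet> x > c" "\<And>i. d \<bullet> bdry G i = c" "d \<bullet> l > 0"
    using halfplane by metis
  then have l: "l \<noteq> 0" by auto
  \<comment> \<open>The coordinate along \<open>l\<close> of the projection of
    \<open>x - bdry G i\<close>.\<close>
  define t where "t = Re (cnj l * (x - bdry G i)) / (cmod l)\<^sup>2"
  have "cnj l * (x - bdry G i) = of_real (t * (cmod l)\<^sup>2)"
    using h l by (auto simp: complex_eq_iff t_def height_def)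
  also have "\<dots> = cnj l * (of_real t * l)"
    by (simp only: of_real_mult complex_norm_square mult_ac)
  finally have "x - bdry G i = t *\<^sub>R l" using l by (simp add: scaleR_conv_of_real)
  then have x: "x = bdry G i + t *\<^sub>R l" by (simp add: algebra_simps)
  then have "t > 0" using dc(1)[OF assms] dc(2)[of i] dc(3)
    by (simp add: inner_add_right zero_less_mult_iff)
  with x show "\<exists>t>0. x = bdry G i + t *\<^sub>R l" by blast
qed

lemma height_inner: "x \<in> inner G \<Longrightarrow> height i x \<noteq> 0"
  using on_ray_iff[OF inner_interior, of x i] gauge
  by (auto simp: gauge_ray_direction_def)

text \<open>A ray meets the edge, and then only once, exactly when it separates \<open>u\<close>
  from \<open>v\<close>. The crossing rays thus form the symmetric difference of the two sets
  counted by \<open>below\<close>.\<close>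

lemma even_ray_crossings:
  assumes e: "(u, v) \<in> edges G" and uv: "u \<in> inner G" "v \<in> inner G"
  shows "even (ray_crossings G l (u, v)) \<longleftrightarrow> (even (below u) \<longleftrightarrow> even (below v))"
proof -
  let ?X = "{(i, x). i \<in> sources G \<and> x \<in> closed_segment u v \<and> height i x = 0}"
  have "convex (interior (disk G))"
    using plabic by (auto simp: plabic_graph_def bdry_on_segment_def intro: convex_interior)
  then have seg: "closed_segment u v \<subseteq> interior (disk G)"
    using uv inner_interior by (intro closed_segment_subset) auto
  \<comment> \<open>The edge is not parallel to \<open>l\<close>, so the height is nonconstant along
    it.\<close>
  have ne: "height i u \<noteq> height i v" for i
  proof -
    have "height i v - height i u = - Im (cnj (v - u) * l)" by (simp add: height_def algebra_simps)
    moreover have "Im (cnj (v - u) * l) \<noteq> 0" using edgeD(4)[OF e] by (auto simp: orient_def split: if_splits)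
    ultimately show ?thesis by auto
  qed
  note lev = segment_meets_level_zero_iff[where h = "height i" and u = u and v = v for i,
      OF height_inner[OF uv(1)] height_inner[OF uv(2)] ne]
  have aff: "height i ((1 - s) *\<^sub>R u + s *\<^sub>R v) = (1 - s) * height i u + s * height i v" for i s
    by (simp add: height_def algebra_simps)
  have "ray_crossings G l (u, v) = card ?X"
    unfolding ray_crossings_def using seg on_ray_iff by (intro arg_cong[where f = card]) auto
  also have "\<dots> = card (fst ` ?X)"
  proof (rule card_image[symmetric])
    show "inj_on fst ?X" using lev(2)[OF aff] by (auto simp: inj_on_def)
  qed
  also have "fst ` ?X = {i \<in> sources G. (height i u < 0) \<noteq> (height i v < 0)}"
    unfolding lev(1)[OF aff, symmetric] by force
  also have "\<dots> = ({i \<in> sources G. height i u < 0} - {i \<in> sources G. height i v < 0}) \<union>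
      ({i \<in> sources G. height i v < 0} - {i \<in> sources G. height i u < 0})"
    by auto
  finally show ?thesis
    using even_card_sym_diff[of "{i \<in> sources G. height i u < 0}" "{i \<in> sources G. height i v < 0}"]
    by (simp add: below_def)
qed

text \<open>Modulo 2 the crossings of the middle edges telescope through \<open>below\<close>. The
  two end edges may touch the boundary, where \<open>even_ray_crossings\<close> does not apply, and
  are kept apart.\<close>

lemma even_path_int:
  assumes P: "edge_path G P" and n: "length P = Suc (Suc n)"
  shows "even (path_int G l P) \<longleftrightarrow>
    even (ray_crossings G l (hd P) + below (snd (hd P)) + ray_crossings G l (last P) + below (fst (last P)))"
proof -
  let ?r = "\<lambda>m. ray_crossings G l (P ! m)"
  have "even (\<Sum>m<k. ?r (Suc m)) \<longleftrightarrow> (even (below (node P 1)) \<longleftrightarrow> even (below (node P (Suc k))))"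
    if "k \<le> n" for k
    using that
  proof (induction k)
    case (Suc k)
    have "P ! Suc k = (node P (Suc k), node P (Suc (Suc k)))"
      "(node P (Suc k), node P (Suc (Suc k))) \<in> edges G"
      using nth_eq_node[OF P] node_edge[OF P] Suc.prems n by auto
    moreover have "node P (Suc k) \<in> inner G" "node P (Suc (Suc k)) \<in> inner G"
      using node_inner[OF P] Suc.prems n by auto
    ultimately show ?case using Suc even_ray_crossings by auto
  qed simp
  from this[of n] have "even (\<Sum>m<n. ?r (Suc m)) \<longleftrightarrow> (even (below (node P 1)) \<longleftrightarrow> even (below (node P (Suc n))))"
    by simp
  moreover have "path_int G l P = ?r 0 + (\<Sum>m<n. ?r (Suc m)) + ?r (Suc n)"
    unfolding path_int_def n by (subst sum.lessThan_Suc_shift) simp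
  moreover have "P ! 0 = hd P" "P ! Suc n = last P"
    using P n by (auto simp: edge_path_def hd_conv_nth last_conv_nth)
  ultimately show ?thesis using hd_eq_node[OF P] last_eq_node[OF P n] by auto
qed

text \<open>A repeated edge would repeat its tail. This settles the one-edge case outside the scope
  of \<open>even_path_int\<close>.\<close>

lemma path_eq_singleton:
  assumes "edge_path G P" "hd P = last P"
  shows "P = [hd P]"
proof -
  obtain n where n: "length P = Suc n" using assms(1) by (cases P) (auto simp: edge_path_def)
  then have "node P 0 = node P n" using hd_eq_node[OF assms(1)] last_eq_node[OF assms(1) n] assms(2) by simp
  then have "n = 0" using node_distinct[OF assms(1), of 0 n] n by auto
  then show ?thesis using n by (cases P) auto
qed

lemma directed_paths_even_int_iff:
  assumes "P \<in> directed_paths G e j" "P' \<in> directed_paths G e j"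
  shows "even (path_int G l P) \<longleftrightarrow> even (path_int G l P')"
proof -
  have P: "edge_path G P" "edge_path G P'" "hd P = e" "hd P' = e" "last P = last P'"
    using assms last_unique[OF assms] by (auto simp: directed_paths_eq)
  show ?thesis
  proof (cases "e = last P")
    case True
    then have "P = [e]" "P' = [e]" using path_eq_singleton P by metis+
    then show ?thesis by simp
  next
    case False
    have "\<exists>n. length Q = Suc (Suc n)" if "edge_path G Q" "hd Q \<noteq> last Q" for Q
      using that by (cases Q rule: remdups_adj.cases) (auto simp: edge_path_def)
    then obtain n n' where "length P = Suc (Suc n)" "length P' = Suc (Suc n')"
      using P False by metis
    then show ?thesis using even_path_int P by metis
  qed
qed

lemma parity_constant:
  assumes "internal_sources G = {}"
  shows "\<exists>\<sigma> :: complex \<times> complex \<Rightarrow> 'n \<Rightarrow> nat. \<forall>e j. \<forall>F\<in>directed_paths G e j.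
    even (path_wind l F + int (path_int G l F)) \<longleftrightarrow> even (\<sigma> e j)"
proof -
  have "\<exists>s::nat. \<forall>F\<in>directed_paths G e j. even (path_wind l F + int (path_int G l F)) \<longleftrightarrow> even s" for e j
  proof (cases "directed_paths G e j = {}")
    case False
    then obtain F where "F \<in> directed_paths G e j" by blast
    then show ?thesis
      using directed_paths_wind_eq[OF assms, of F e j] directed_paths_even_int_iff[of F e j]
      \<comment> \<open>Any sample path fixes the parity.\<close>
      by (intro exI[of _ "if even (path_wind l F + int (path_int G l F)) then 0 else 1"]) auto
  qed auto
  then show ?thesis by metis
qed

section \<open>Existence and finiteness of paths to the boundary\<close>

text \<open>The only edge at a boundary source leaves it. Hence the components of an edge vector at
  sources vanish.\<close>

lemma no_path_to_source:
  assumes "j \<in> sources G"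
  shows "directed_paths G e j = {}"
proof -
  obtain v where "(bdry G j, v) \<in> edges G" using assms by (auto simp: source_set_def)
  moreover have "last P \<in> edges G \<and> snd (last P) = bdry G j" if "P \<in> directed_paths G e j" for P
    using that by (auto simp: directed_paths_def)
  ultimately show ?thesis using bdry_not_passed by (metis ex_in_conv prod.collapse)
qed

text \<open>Acyclicity prevents repeated edges, leaving only duplicate-free lists over a finite
  set.\<close>

lemma finite_directed_paths: "finite (directed_paths G e j)"
proof -
  have "distinct P" if "edge_path G P" for P
    unfolding distinct_conv_nth
    using nth_eq_node[OF that] node_distinct[OF that] by (metis less_imp_le prod.inject)
  then have "directed_paths G e j \<subseteq> {P. set P \<subseteq> edges G \<and> distinct P}"
    by (auto simp: directed_paths_eq edge_path_def)
  then show ?thesis using finite_subset_distinct[OF finite_edges] finite_subset by blast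
qed

text \<open>The mirror image of \<open>path_from_bdry\<close>: follow outgoing edges until the
  boundary is reached.\<close>

lemma path_to_bdry:
  assumes "internal_sinks G = {}" "(u, v) \<in> edges G"
  shows "\<exists>j. directed_paths G (u, v) j \<noteq> {}"
proof -
  have "wf ((edges G)\<inverse>)" using finite_acyclic_wf_converse finite_edges acyclic by blast
  then show ?thesis using assms(2)
  proof (induction v arbitrary: u rule: wf_induct_rule)
    case (less v)
    show ?case
    proof (cases "v \<in> inner G")
      case True
      then obtain w where w: "(v, w) \<in> edges G" using assms(1) by (auto simp: internal_sinks_def)
      from less.IH[OF _ w] w obtain j P where "P \<in> directed_paths G (v, w) j" by auto
      then have "(u, v) # P \<in> directed_paths G (u, v) j"
        using less.prems by (auto simp: directed_paths_eq edge_path_def successively_Cons)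
      then show ?thesis by blast
    next
      case False
      then obtain j where "v = bdry G j" using edgeD(3)[OF less.prems] by (auto simp: vertices_def)
      then have "[(u, v)] \<in> directed_paths G (u, v) j"
        using less.prems by (auto simp: directed_paths_eq edge_path_def)
      then show ?thesis by blast
    qed
  qed
qed

end


section \<open>Le-networks\<close>

lemma le_diagram_box:
  assumes "le_diagram n lam D" "(r, c) \<in> D"
  shows "r < length lam" "c < lam ! r" "lam ! r \<le> n - length lam" "length lam \<le> n"
  using assms by (auto simp: le_diagram_def young_diagram_def boxes_def)

lemma row_step_less:
  assumes "le_diagram n lam D" "(r, c) \<in> D"
  shows "row_step n lam r < n"
  using le_diagram_box[OF assms] by (auto simp: row_step_def)

lemma col_step_less:
  assumes "le_diagram n lam D" "(r, c) \<in> D"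
  shows "col_step n lam c < n"
proof -
  have "card {r. r < length lam \<and> c < lam ! r} \<le> card {..<length lam}"
    by (intro card_mono) auto
  then show ?thesis using le_diagram_box[OF assms] by (auto simp: col_step_def)
qed

lemma le_edges_vertices:
  assumes "le_diagram n lam D" "(a, b) \<in> le_horizontal n lam D \<union> le_vertical n lam D \<union> le_resolving D"
  shows "a \<in> le_vertices n D \<and> b \<in> le_vertices n D"
proof -
  have mem: "Step m \<in> le_vertices n D \<longleftrightarrow> m < n" "Entry r c \<in> le_vertices n D \<longleftrightarrow> (r, c) \<in> D"
    "Exit r c \<in> le_vertices n D \<longleftrightarrow> resolved D r c" for m r c
    by (auto simp: le_vertices_def)
  then have out: "(r, c) \<in> D \<Longrightarrow> out_vertex D r c \<in> le_vertices n D" for r c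
    by (simp add: out_vertex_def)
  have res: "resolved D r c \<Longrightarrow> (r, c) \<in> D" for r c by (simp add: resolved_def)
  show ?thesis
    using assms(2) unfolding le_horizontal_def le_vertical_def le_resolving_def
    by (elim UnE CollectE exE conjE Pair_inject)
      (simp_all add: mem out res row_step_less[OF assms(1)] col_step_less[OF assms(1)])
qed

text \<open>Moving left or down increases \<open>r + (n - c)\<close>; doubling makes room for the
  exit of a resolved box. The value at \<open>Step\<close> is a placeholder, as boundary vertices
  are ranked separately.\<close>

fun le_rank :: "nat \<Rightarrow> le_vertex \<Rightarrow> nat" where
  "le_rank n (Step m) = 0"
| "le_rank n (Entry r c) = 2 * (r + (n - c))"
| "le_rank n (Exit r c) = 2 * (r + (n - c)) + 1"

lemma le_rank_less:
  assumes "le_diagram n lam D" "w \<in> le_vertices n D"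
  shows "le_rank n w < 4 * n + 2"
proof -
  have "r < n" if "(r, c) \<in> D" for r c using le_diagram_box[OF assms(1) that] by simp
  then have "2 * (r + (n - c)) + 1 < 4 * n + 2" if "(r, c) \<in> D" for r c
    using that by fastforce
  then show ?thesis using assms(2) by (fastforce simp: le_vertices_def resolved_def)
qed

lemma le_rank_edge:
  assumes "le_diagram n lam D" "(a, b) \<in> le_horizontal n lam D \<union> le_vertical n lam D \<union> le_resolving D"
    and "a \<notin> range Step" "b \<notin> range Step"
  shows "le_rank n a < le_rank n b"
proof -
  \<comment> \<open>This bound keeps the truncated difference \<open>n - c\<close> strictly monotone
    under moves to the left.\<close>
  have col: "c < n" if "(r, c) \<in> D" for r c using le_diagram_box[OF assms(1) that] by simp
  have out: "le_rank n (out_vertex D r c) \<le> 2 * (r + (n - c)) + 1" for r c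
    by (auto simp: out_vertex_def)
  from assms(2-4) consider
      (left) r c c' where "a = out_vertex D r c" "b = Entry r c'" "(r, c) \<in> D" "c' < c"
    | (down) r c r' where "a = out_vertex D r c" "b = Entry r' c" "r < r'"
    | (within) r c where "a = Entry r c" "b = Exit r c"
    by (auto simp: le_horizontal_def le_vertical_def le_resolving_def)
  then show ?thesis
  proof cases
    case left
    then show ?thesis using col[of r c] out[of r c] by auto
  next
    case down
    then show ?thesis using out[of r c] by auto
  qed auto
qed

text \<open>An entry is reached from the nearest 1 to its right or, if there is none, from the
  source of its row; an exit is reached from its own entry.\<close>

lemma le_vertex_has_predecessor:
  assumes "w \<in> le_vertices n D" "w \<notin> range Step"
  shows "\<exists>a. (a, w) \<in> le_horizontal n lam D \<union> le_vertical n lam D \<union> le_resolving D"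
proof (cases w)
  case (Entry r c)
  then have rc: "(r, c) \<in> D" using assms by (auto simp: le_vertices_def)
  show ?thesis
  proof (cases "\<exists>c'>c. (r, c') \<in> D")
    case True
    define c' where "c' = (LEAST c'. c' > c \<and> (r, c') \<in> D)"
    have "c' > c \<and> (r, c') \<in> D" unfolding c'_def using True by (rule LeastI_ex)
    moreover have "(r, d) \<notin> D" if "c < d \<and> d < c'" for d
      using that not_less_Least unfolding c'_def by blast
    ultimately have "(out_vertex D r c', w) \<in> le_horizontal n lam D"
      using rc Entry by (auto simp: le_horizontal_def)
    then show ?thesis by blast
  next
    case False
    then have "(Step (row_step n lam r), w) \<in> le_horizontal n lam D"
      using rc Entry by (auto simp: le_horizontal_def)
    then show ?thesis by blast
  qed
next
  case (Exit r c)
  then have "(Entry r c, w) \<in> le_resolving D"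
    using assms by (auto simp: le_vertices_def le_resolving_def)
  then show ?thesis by blast
qed (use assms in auto)

text \<open>Counting predecessors is strictly monotone, hence a bijection onto the initial segment
  of that size. So every \<open>Step\<close> of the diagram is some boundary vertex.\<close>

lemma ex_card_less_eq:
  assumes "m < CARD('n::{finite,linorder})"
  shows "\<exists>i::'n. card {i'. i' < i} = m"
proof -
  let ?g = "\<lambda>i::'n. card {i'. i' < i}"
  have lt: "?g i < ?g j" if "i < j" for i j
    using that by (intro psubset_card_mono) auto
  have "inj ?g"
  proof (rule injI)
    fix i j assume "?g i = ?g j"
    then show "i = j" using lt[of i j] lt[of j i] by (cases i j rule: linorder_cases) auto
  qed
  then have "card (range ?g) = card {..<CARD('n)}" by (simp add: card_image)
  moreover have "range ?g \<subseteq> {..<CARD('n)}"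
    by (auto intro!: psubset_card_mono)
  ultimately have "range ?g = {..<CARD('n)}" by (intro card_subset_eq) auto
  then show ?thesis using assms by (metis (mono_tags, lifting) imageE lessThan_iff)
qed

text \<open>Both properties are transported from the diagram along the drawing \<open>f\<close>:
  acyclicity through a rank that grows along edges, incoming edges through
  \<open>le_vertex_has_predecessor\<close>.\<close>

lemma le_network_acyclic_no_sources:
  fixes N :: "'n::{finite,linorder} plabic_network"
  assumes "le_network N" "gauge_ray_direction N l"
  shows "acyclic (edges N) \<and> internal_sources N = {}"
proof -
  let ?n = "CARD('n)"
  obtain lam D f where le: "le_diagram ?n lam D"
    and bij: "bij_betw f (le_vertices ?n D) (vertices N)"
    and bd: "\<And>i. f (Step (card {i'. i' < i})) = bdry N i"
    and ed: "edges N = map_prod f f ` (le_horizontal ?n lam D \<union> le_vertical ?n lam D \<union> le_resolving D)"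
    using assms(1) unfolding le_network_def Let_def by blast
  have "plabic_graph N" using assms(1) by (simp add: le_network_def plabic_network_def)
  then interpret gauged_plabic N l using assms(2) by unfold_locales
  let ?E = "le_horizontal ?n lam D \<union> le_vertical ?n lam D \<union> le_resolving D"
  have Step_vertex: "Step m \<in> le_vertices ?n D \<longleftrightarrow> m < ?n" for m by (auto simp: le_vertices_def)
  have bdry_iff: "f w \<in> range (bdry N) \<longleftrightarrow> w \<in> range Step" if w: "w \<in> le_vertices ?n D" for w
  proof
    assume "w \<in> range Step"
    then show "f w \<in> range (bdry N)"
      using w Step_vertex ex_card_less_eq bd by (metis image_iff rangeI)
  next
    assume "f w \<in> range (bdry N)"
    then obtain i where "f w = bdry N i" by auto
    then have "f w = f (Step (card {i'. i' < i}))" using bd by simp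
    moreover have "card {i'. i' < i} < ?n" by (auto intro!: psubset_card_mono)
    ultimately have "w = Step (card {i'. i' < i})"
      using w bij Step_vertex by (auto simp: bij_betw_def dest: inj_onD)
    then show "w \<in> range Step" by blast
  qed
  \<comment> \<open>Boundary sources come first, then internal vertices by \<open>le_rank\<close>,
    and finally boundary sinks, placed above the bound of \<open>le_rank_less\<close>.\<close>
  define \<rho> where "\<rho> x = (if x \<in> range (bdry N) then if \<exists>y. (x, y) \<in> edges N then 0 else 4 * ?n + 3
    else Suc (le_rank ?n (inv_into (le_vertices ?n D) f x)))" for x
  have "\<rho> x < \<rho> y" if xy: "(x, y) \<in> edges N" for x y
  proof -
    obtain a b where ab: "x = f a" "y = f b" "(a, b) \<in> ?E" using xy unfolding ed by force
    have V: "a \<in> le_vertices ?n D" "b \<in> le_vertices ?n D" using le_edges_vertices[OF le ab(3)] by auto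
    then have inv: "inv_into (le_vertices ?n D) f x = a" "inv_into (le_vertices ?n D) f y = b"
      using bij ab by (auto simp: bij_betw_def)
    have \<rho>y: "\<rho> y = 4 * ?n + 3" if "y \<in> range (bdry N)"
      using that xy bdry_not_passed by (auto simp: \<rho>_def)
    show ?thesis
    proof (cases "x \<in> range (bdry N)")
      case True
      then have "\<rho> x = 0" using xy by (auto simp: \<rho>_def)
      then show ?thesis using \<rho>y by (cases "y \<in> range (bdry N)") (auto simp: \<rho>_def)
    next
      case False
      then have \<rho>x: "\<rho> x = Suc (le_rank ?n a)" by (simp add: \<rho>_def inv)
      show ?thesis
      proof (cases "y \<in> range (bdry N)")
        case True
        then show ?thesis using \<rho>y \<rho>x le_rank_less[OF le V(1)] by simp
      next
        case y: False
        then have "le_rank ?n a < le_rank ?n b"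
          using le_rank_edge[OF le ab(3)] bdry_iff V ab False by auto
        then show ?thesis using y \<rho>x by (simp add: \<rho>_def inv)
      qed
    qed
  qed
  then have "edges N \<subseteq> inv_image less_than \<rho>" by auto
  then have "acyclic (edges N)" by (intro wf_acyclic wf_subset[OF wf_inv_image[OF wf_less_than]])
  moreover have "\<exists>u. (u, x) \<in> edges N" if x: "x \<in> inner N" for x
  proof -
    have "x \<in> vertices N" using x by (simp add: vertices_def)
    then obtain w where w: "w \<in> le_vertices ?n D" "x = f w" using bij by (auto simp: bij_betw_def)
    have "x \<notin> range (bdry N)" using bdry_notin_inner x by auto
    then have "w \<notin> range Step" using bdry_iff w by auto
    then obtain a where "(a, w) \<in> ?E" using le_vertex_has_predecessor[OF w(1)] by blast
    then have "(f a, x) \<in> edges N" unfolding ed w by force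
    then show ?thesis by blast
  qed
  ultimately show ?thesis by (auto simp: internal_sources_def)
qed


section \<open>Edge vectors\<close>

text \<open>Components at sources vanish by \<open>no_path_to_source\<close>; in the others the
  constant parity lets the sign be pulled out of the sum.\<close>

lemma edge_vector_formula:
  fixes N :: "'n::{finite,linorder} plabic_network"
  assumes "acyclic_plabic N l" "internal_sources N = {}"
  shows "\<exists>\<sigma> :: complex \<times> complex \<Rightarrow> 'n \<Rightarrow> nat. \<forall>e\<in>edges N.
    (\<forall>j\<in>- sources N. \<forall>F\<in>directed_paths N e j. even (path_wind l F + int (path_int N l F)) \<longleftrightarrow> even (\<sigma> e j)) \<and>
    edge_vector N l e =
      (\<Sum>j\<in>- sources N. (\<Sum>F\<in>directed_paths N e j.
         (-1) powi (path_wind l F + int (path_int N l F)) * path_weight N F) *\<^sub>R axis j 1) \<and>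
    edge_vector N l e =
      (\<Sum>j\<in>- sources N. ((-1) ^ \<sigma> e j * (\<Sum>F\<in>directed_paths N e j. path_weight N F)) *\<^sub>R axis j 1)"
proof -
  interpret acyclic_plabic N l by fact
  obtain \<sigma> :: "complex \<times> complex \<Rightarrow> 'n \<Rightarrow> nat" where \<sigma>: "\<And>e j F. F \<in> directed_paths N e j \<Longrightarrow>
      even (path_wind l F + int (path_int N l F)) \<longleftrightarrow> even (\<sigma> e j)"
    using parity_constant[OF assms(2)] by metis
  let ?c = "\<lambda>e j. \<Sum>F\<in>directed_paths N e j. (-1) powi (path_wind l F + int (path_int N l F)) * path_weight N F"
  have 1: "edge_vector N l e = (\<Sum>j\<in>- sources N. ?c e j *\<^sub>R axis j 1)" for e
  proof (rule vec_eq_iff[THEN iffD2], rule allI)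
    fix k
    have "(\<Sum>j\<in>- sources N. ?c e j *\<^sub>R axis j 1) $ k = (\<Sum>j\<in>- sources N. if j = k then ?c e j else 0)"
      by (simp add: sum_component axis_def if_distrib[where f = "\<lambda>x. _ * x"] eq_commute cong: if_cong)
    also have "\<dots> = ?c e k" using no_path_to_source[of k e] by (auto simp: sum.delta)
    finally show "edge_vector N l e $ k = (\<Sum>j\<in>- sources N. ?c e j *\<^sub>R axis j 1) $ k"
      by (simp add: edge_vector_def)
  qed
  have "(-1) powi (path_wind l F + int (path_int N l F)) = (-1 :: real) ^ \<sigma> e j"
    if "F \<in> directed_paths N e j" for e j F
    using \<sigma>[OF that] by (cases "even (\<sigma> e j)") simp_all
  then have "?c e j = (-1) ^ \<sigma> e j * (\<Sum>F\<in>directed_paths N e j. path_weight N F)" for e j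
    by (simp add: sum_distrib_left)
  with 1 \<sigma> show ?thesis by (intro exI[of _ \<sigma>]) auto
qed

text \<open>At a sink reachable from \<open>e\<close> all contributions have the same sign, so the
  positive weights cannot cancel.\<close>

lemma edge_vector_nonzero:
  fixes N :: "'n::{finite,linorder} plabic_network"
  assumes "acyclic_plabic N l" "plabic_network N" "internal_sources N = {}" "internal_sinks N = {}"
    and "e \<in> edges N"
  shows "edge_vector N l e \<noteq> 0"
proof -
  interpret acyclic_plabic N l by fact
  obtain j where j: "directed_paths N e j \<noteq> {}"
    using path_to_bdry[OF assms(4), of "fst e" "snd e"] assms(5) by auto
  then have j': "j \<in> - sources N" using no_path_to_source[of j e] by auto
  obtain s :: nat where s: "\<And>F. F \<in> directed_paths N e j \<Longrightarrow>
      even (path_wind l F + int (path_int N l F)) \<longleftrightarrow> even s"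
    using parity_constant[OF assms(3)] by metis
  have "path_weight N F > 0" if "F \<in> directed_paths N e j" for F
    using that assms(2) nth_mem
    by (auto simp: path_weight_def directed_paths_def plabic_network_def intro!: prod_pos)
  then have "(\<Sum>F\<in>directed_paths N e j. path_weight N F) > 0"
    using j finite_directed_paths by (intro sum_pos) auto
  moreover have "(-1) powi (path_wind l F + int (path_int N l F)) = (-1 :: real) ^ s"
    if "F \<in> directed_paths N e j" for F
    using s[OF that] by (cases "even s") simp_all
  then have "edge_vector N l e $ j = (-1) ^ s * (\<Sum>F\<in>directed_paths N e j. path_weight N F)"
    by (simp add: edge_vector_def sum_distrib_left)
  ultimately show ?thesis by auto
qed

theorem theorem6p1:
  fixes N :: "'n::{finite,linorder} plabic_network" and l :: complex
  assumes "plabic_network N"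
    and "irreducible_cell (positroid N)"
    and "gauge_ray_direction N l"
  shows
    "(acyclic (edges N) \<and> internal_sources N = {} \<and> internal_sinks N = {} \<longrightarrow>
        (\<forall>e\<in>edges N. edge_vector N l e \<noteq> 0) \<and>
        (\<exists>\<sigma> :: complex \<times> complex \<Rightarrow> 'n \<Rightarrow> nat. \<forall>e\<in>edges N.
           (\<forall>j\<in>- sources N. \<forall>F\<in>directed_paths N e j.
              even (path_wind l F + int (path_int N l F)) \<longleftrightarrow> even (\<sigma> e j)) \<and>
           edge_vector N l e =
             (\<Sum>j\<in>- sources N. (\<Sum>F\<in>directed_paths N e j.
                (-1) powi (path_wind l F + int (path_int N l F)) * path_weight N F)
                *\<^sub>R axis j 1) \<and>
           edge_vector N l e =
             (\<Sum>j\<in>- sources N. ((-1) ^ \<sigma> e j * (\<Sum>F\<in>directed_paths N e j. path_weight N F))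
                *\<^sub>R axis j 1))) \<and>
     (le_network N \<longrightarrow>
        (\<exists>\<sigma> :: complex \<times> complex \<Rightarrow> 'n \<Rightarrow> nat. \<forall>e\<in>edges N.
           (\<forall>j\<in>- sources N. \<forall>F\<in>directed_paths N e j.
              even (path_wind l F + int (path_int N l F)) \<longleftrightarrow> even (\<sigma> e j)) \<and>
           edge_vector N l e =
             (\<Sum>j\<in>- sources N. (\<Sum>F\<in>directed_paths N e j.
                (-1) powi (path_wind l F + int (path_int N l F)) * path_weight N F)
                *\<^sub>R axis j 1) \<and>
           edge_vector N l e =
             (\<Sum>j\<in>- sources N. ((-1) ^ \<sigma> e j * (\<Sum>F\<in>directed_paths N e j. path_weight N F))
                *\<^sub>R axis j 1)))"
proof (intro conjI impI, goal_cases)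
  have plabic: "acyclic_plabic N l" if "acyclic (edges N)"
    using assms that by unfold_locales (simp_all add: plabic_network_def)
  {
    case 1
    then show ?case using edge_vector_nonzero[OF plabic assms(1)] by blast
  next
    case 2
    then show ?case by (intro edge_vector_formula plabic) blast+
  next
    case 3
    then show ?case
      by (intro edge_vector_formula plabic) (use le_network_acyclic_no_sources assms(3) in blast)+
  }
qed

end
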